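(* Let $\kappa$ be a regular cardinal. If superclub holds at $\kappa^+$, then $Q(\kappa^+,\kappa^+,\kappa^+)$ holds.
   Context: For a regular uncountable cardinal $\lambda$, $\lim(\lambda)$ denotes the set of limit ordinals below $\lambda$. A superclub sequence at $\lambda$ is a sequence $(S_\alpha:\alpha\in\lim(\lambda))$ such that each $S_\alpha$ is an unbounded subset of $\alpha$, and for every $A\subseteq\lambda$ with $|A|=\lambda$ there is $B\subseteq A$ with $|B|=\lambda$ such that $\{\alpha\in\lim(\lambda):B\cap\alpha=S_\alpha\}$ is stationary in $\lambda$; superclub holds at $\lambda$ iff such a sequence exists. For a graph $G=(V,E)$, a set $I\subseteq V$ is independent iff no edge of $E$ has both endpoints in $I$. For cardinals $\kappa',\mu\leq\lambda$, $Q(\lambda,\kappa',\mu)$ means: for every graph $G=(\lambda,E)$ with no independent subset of size $\kappa'$ there is a partition $(E_\alpha:\alpha<\mu)$ of $E$ such that for every $\alpha<\mu$ the graph $(\lambda,E_\alpha)$ has no independent subset of size $\kappa'$. *)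

theory Defs
  imports Main "HOL-Library.Disjoint_Sets" "HOL-Library.Ramsey"
begin

unbundle cardinal_syntax

text \<open>
  Cardinals are cardinal orders in the sense of the HOL library: a cardinal \<open>\<lambda>\<close> is a
  well-order relation \<open>r\<close> with \<open>Card_order r\<close>. The ordinals below \<open>\<lambda>\<close> are the elements
  of \<open>Field r\<close>, and such an ordinal \<open>\<alpha>\<close>, viewed as the set of smaller ordinals, is
  \<open>underS r \<alpha>\<close>; so \<open>B \<inter> \<alpha>\<close> is written \<open>B \<inter> underS r \<alpha>\<close>. The property \<open>|A| = \<lambda>\<close>
  is \<open>|A| =o r\<close>.
\<close>

definition limits :: "'a rel \<Rightarrow> 'a set" where
  "limits r = {\<alpha> \<in> Field r. underS r \<alpha> \<noteq> {} \<and>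
                 (\<forall>\<beta> \<in> underS r \<alpha>. \<exists>\<gamma> \<in> underS r \<alpha>. \<beta> \<in> underS r \<gamma>)}"

definition unbounded_below :: "'a rel \<Rightarrow> 'a \<Rightarrow> 'a set \<Rightarrow> bool" where
  "unbounded_below r \<alpha> S \<longleftrightarrow>
     S \<subseteq> underS r \<alpha> \<and> (\<forall>\<beta> \<in> underS r \<alpha>. \<exists>\<gamma> \<in> S. \<beta> \<in> underS r \<gamma>)"

definition club :: "'a rel \<Rightarrow> 'a set \<Rightarrow> bool" where
  "club r C \<longleftrightarrow>
     C \<subseteq> Field r \<and> cofinal C r \<and>
     (\<forall>\<alpha> \<in> limits r. unbounded_below r \<alpha> (C \<inter> underS r \<alpha>) \<longrightarrow> \<alpha> \<in> C)"

definition stationary :: "'a rel \<Rightarrow> 'a set \<Rightarrow> bool" where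
  "stationary r X \<longleftrightarrow> X \<subseteq> Field r \<and> (\<forall>C. club r C \<longrightarrow> X \<inter> C \<noteq> {})"

text \<open>
  The next two notions are meant for a regular uncountable cardinal \<open>r\<close>. The values of
  \<open>S\<close> outside \<open>limits r\<close> are irrelevant.
\<close>

definition superclub_sequence :: "'a rel \<Rightarrow> ('a \<Rightarrow> 'a set) \<Rightarrow> bool" where
  "superclub_sequence r S \<longleftrightarrow>
     (\<forall>\<alpha> \<in> limits r. unbounded_below r \<alpha> (S \<alpha>)) \<and>
     (\<forall>A \<subseteq> Field r. |A| =o r \<longrightarrow>
        (\<exists>B \<subseteq> A. |B| =o r \<and> stationary r {\<alpha> \<in> limits r. B \<inter> underS r \<alpha> = S \<alpha>}))"

definition superclub :: "'a rel \<Rightarrow> bool" where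
  "superclub r \<longleftrightarrow> (\<exists>S. superclub_sequence r S)"

text \<open>
  A graph on the vertex set \<open>V\<close> is given by its edge set \<open>E \<subseteq> [V]\<^bsup>2\<^esup>\<close>.
\<close>

definition independent_set :: "'a set \<Rightarrow> 'a set set \<Rightarrow> 'a set \<Rightarrow> bool" where
  "independent_set V E I \<longleftrightarrow> I \<subseteq> V \<and> (\<forall>e \<in> E. \<not> e \<subseteq> I)"

definition has_independent_of_size :: "'a set \<Rightarrow> 'a set set \<Rightarrow> 'b rel \<Rightarrow> bool" where
  "has_independent_of_size V E k \<longleftrightarrow> (\<exists>I. independent_set V E I \<and> |I| =o k)"

text \<open>
  \<open>Q r k m\<close> is \<open>Q(\<lambda>, \<kappa>', \<mu>)\<close>, meant for cardinals \<open>k, m \<le>o r\<close>. Pieces of a partition are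
  not required to be nonempty in the definition; an empty piece would make the whole vertex
  set independent, hence give an independent set of size \<open>k\<close>, which the last condition
  excludes.
\<close>

definition Q :: "'a rel \<Rightarrow> 'b rel \<Rightarrow> 'c rel \<Rightarrow> bool" where
  "Q r k m \<longleftrightarrow>
     (\<forall>E. E \<subseteq> [Field r]\<^bsup>2\<^esup> \<and> \<not> has_independent_of_size (Field r) E k \<longrightarrow>
        (\<exists>P :: 'c \<Rightarrow> 'a set set.
           disjoint_family_on P (Field m) \<and> (\<Union>\<alpha> \<in> Field m. P \<alpha>) = E \<and>
           (\<forall>\<alpha> \<in> Field m. \<not> has_independent_of_size (Field r) (P \<alpha>) k)))"

end

theory Submission
  imports Defs
begin

text \<open>
  Let \<open>\<lambda> = \<kappa>\<^sup>+\<close>. For each vertex \<open>\<beta>\<close> there are at most \<open>\<kappa>\<close> guesses \<open>S\<^sub>\<alpha>\<close> with \<open>\<alpha> \<le> \<beta>\<close> containing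
  \<open>\<kappa>\<close> many neighbours of \<open>\<beta>\<close>. Picking distinct representatives, the edges going down from \<open>\<beta>\<close>
  are coloured so that each of these sets of neighbours receives all colours below \<open>\<beta>\<close>.

  Suppose that \<open>I\<close> has size \<open>\<lambda>\<close> and is independent in colour \<open>\<xi>\<close>, and let \<open>B \<subseteq> I\<close> be guessed
  on an unbounded set \<open>T\<close>. By the choice of the colouring, no \<open>\<beta> \<in> B\<close> above \<open>\<xi>\<close> has \<open>\<kappa>\<close>
  neighbours in \<open>B \<inter> \<alpha>\<close>, for any \<open>\<alpha> \<in> T\<close> with \<open>\<alpha> \<le> \<beta>\<close>. Thin \<open>B\<close> out to a set of size \<open>\<lambda>\<close> such
  that each of its elements \<open>\<beta>\<close> is separated by an element of \<open>T\<close> from all the smaller ones: then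
  \<open>\<beta>\<close> has fewer than \<open>\<kappa>\<close> smaller neighbours, so the greedy colouring uses only \<open>\<kappa>\<close> colours, and
  one of its classes is an independent set of size \<open>\<lambda>\<close> in the original graph.
\<close>

section \<open>Initial segments of well-orders and of infinite cardinals\<close>

lemma Well_order_underS_total:
  assumes "Well_order r" "a \<in> Field r" "b \<in> Field r" "a \<noteq> b"
  shows "a \<in> underS r b \<or> b \<in> underS r a"
  using assms by (auto simp: order_on_defs total_on_def underS_def)

lemma Well_order_underS_asym:
  assumes "Well_order r" "a \<in> underS r b"
  shows "b \<notin> underS r a"
  using assms by (auto simp: order_on_defs underS_def dest: antisymD)

lemma Well_order_not_underS:
  assumes "Well_order r" "a \<in> Field r" "b \<in> Field r" "b \<notin> underS r a"
  shows "(a, b) \<in> r"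
  using assms Well_order_underS_total[of r a b]
  by (cases "a = b") (auto simp: order_on_defs underS_def dest: refl_onD)

lemma Well_order_underS_mono:
  assumes "Well_order r" "(a, b) \<in> r"
  shows "underS r a \<subseteq> underS r b"
  using assms by (intro underS_incr) (auto simp: order_on_defs)

lemma card_of_under:
  assumes r: "Cinfinite r" and a: "a \<in> Field r"
  shows "|under r a| <o r"
proof -
  have inf: "infinite (Field r)" and cr: "Card_order r"
    using r by (auto simp: cinfinite_def)
  have "|{a}| <o r"
    using inf cr by (intro finite_ordLess_infinite)
      (auto simp: Field_card_of intro: card_order_on_well_order_on card_of_card_order_on)
  then have "|underS r a \<union> {a}| <o r"
    using card_of_Un_ordLess_infinite_Field[OF inf cr] card_of_underS[OF cr a] by blast
  moreover have "under r a \<subseteq> underS r a \<union> {a}"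
    unfolding under_def underS_def by blast
  ultimately show ?thesis using card_of_mono1 ordLeq_ordLess_trans by blast
qed

section \<open>Transfinite recursion with choices, and its uses\<close>

lemma Well_order_dependent_choice:
  assumes r: "Well_order r"
    and adm: "\<And>f g x y. (\<And>z. z \<in> underS r x \<Longrightarrow> f z = g z) \<Longrightarrow> P f x y = P g x y"
    and ex: "\<And>x f. \<lbrakk>x \<in> Field r; \<And>y. y \<in> underS r x \<Longrightarrow> P f y (f y)\<rbrakk> \<Longrightarrow> \<exists>y. P f x y"
  shows "\<exists>f. \<forall>x \<in> Field r. P f x (f x)"
proof -
  \<comment> \<open>\<open>dependent_wf_choice\<close> ranges over the whole type; the guard makes
    the condition vacuous outside \<open>Field r\<close>, where \<open>ex\<close> says
    nothing.\<close>
  let ?P = "\<lambda>f x y. x \<in> Field r \<longrightarrow> P f x y"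
  have "\<exists>f. \<forall>x. ?P f x (f x)"
  proof (rule dependent_wf_choice)
    show "wf (r - Id)"
      using r by (simp add: well_order_on_def)
    show "?P f x y = ?P g x y" if "\<And>z. (z, x) \<in> r - Id \<Longrightarrow> f z = g z" for f g x y
      using that adm[of x f g y] by (auto simp: underS_def)
    show "\<exists>y. ?P f x y" if "\<And>y. (y, x) \<in> r - Id \<Longrightarrow> ?P f y (f y)" for x f
      using that ex[of x f] by (auto simp: underS_def Field_def)
  qed
  then show ?thesis by blast
qed

lemma not_subset_image_if_card_less:
  assumes "|X| <o |A|"
  shows "\<exists>a \<in> A. a \<notin> f ` X"
proof (rule ccontr)
  assume "\<not> ?thesis"
  then have "|A| \<le>o |f ` X|"
    by (intro card_of_mono1) blast
  then have "|A| \<le>o |X|"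
    using card_of_image ordLeq_transitive by blast
  with assms show False
    using not_ordLess_ordLeq by blast
qed

text \<open>Well-order \<open>I\<close> in its cardinal type: at each stage fewer than
  \<open>|I|\<close> values have been used, so \<open>A i\<close> still contains a fresh
  one.\<close>

lemma ex_inj_selector:
  assumes "\<And>i. i \<in> I \<Longrightarrow> |I| \<le>o |A i|"
  shows "\<exists>f. inj_on f I \<and> (\<forall>i \<in> I. f i \<in> A i)"
proof -
  let ?r = "|I|"
  have F: "Field ?r = I" by (simp add: Field_card_of)
  have wo: "Well_order ?r" by (rule card_of_Well_order)
  have "\<exists>f. \<forall>i \<in> Field ?r. f i \<in> A i \<and> f i \<notin> f ` underS ?r i"
  proof (rule Well_order_dependent_choice[OF wo])
    show "(y \<in> A i \<and> y \<notin> f ` underS ?r i) = (y \<in> A i \<and> y \<notin> g ` underS ?r i)"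
      if "\<And>z. z \<in> underS ?r i \<Longrightarrow> f z = g z" for f g i y
      using that by (metis (no_types, lifting) image_cong)
    show "\<exists>y. y \<in> A i \<and> y \<notin> f ` underS ?r i" if "i \<in> Field ?r" for i f
    proof -
      have "|underS ?r i| <o |I|"
        using that by (intro card_of_underS card_of_Card_order)
      then have "|underS ?r i| <o |A i|"
        using assms that F ordLess_ordLeq_trans by blast
      then show ?thesis
        using not_subset_image_if_card_less by blast
    qed
  qed
  then obtain f where f: "\<forall>i \<in> I. f i \<in> A i \<and> f i \<notin> f ` underS ?r i"
    using F by auto
  have "inj_on f I"
  proof (rule inj_onI, rule ccontr)
    fix i j assume ij: "i \<in> I" "j \<in> I" "f i = f j" "i \<noteq> j"
    then have "i \<in> underS ?r j \<or> j \<in> underS ?r i"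
      using Well_order_underS_total[OF wo] F by blast
    with f ij show False by (metis imageI)
  qed
  with f show ?thesis by blast
qed

text \<open>At stage \<open>j\<close> fewer than \<open>k\<close> colours are forbidden, so one of
  the \<open>k\<close> colours is free.\<close>

lemma greedy_colouring:
  assumes r: "Well_order r" and k: "Card_order k"
    and few: "\<And>j. j \<in> Field r \<Longrightarrow> |{i \<in> underS r j. R i j}| <o k"
  shows "\<exists>c. \<forall>j \<in> Field r. c j \<in> Field k \<and> (\<forall>i \<in> underS r j. R i j \<longrightarrow> c i \<noteq> c j)"
proof (rule Well_order_dependent_choice[OF r])
  show "(y \<in> Field k \<and> (\<forall>i \<in> underS r j. R i j \<longrightarrow> f i \<noteq> y)) =
      (y \<in> Field k \<and> (\<forall>i \<in> underS r j. R i j \<longrightarrow> g i \<noteq> y))"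
    if "\<And>z. z \<in> underS r j \<Longrightarrow> f z = g z" for f g j y
    using that by auto
  show "\<exists>y. y \<in> Field k \<and> (\<forall>i \<in> underS r j. R i j \<longrightarrow> f i \<noteq> y)" if "j \<in> Field r" for j f
  proof -
    have "|{i \<in> underS r j. R i j}| <o |Field k|"
      using few[OF that] k card_of_Field_ordIso ordIso_symmetric ordLess_ordIso_trans by blast
    from not_subset_image_if_card_less[OF this, of f] show ?thesis by blast
  qed
qed

text \<open>By regularity the values chosen before stage \<open>j\<close> are bounded by some
  \<open>a\<close>. Next come \<alpha> in \<open>T\<close> above \<open>a\<close> and the new value
  in \<open>B\<close> above \<alpha>, so that \<alpha> separates it from all the earlier
  ones.\<close>

lemma regularCard_interleave:
  assumes r: "Card_order r" and reg: "regularCard r"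
    and B: "B \<subseteq> Field r" "cofinal B r" and T: "T \<subseteq> Field r" "cofinal T r"
  shows "\<exists>h. \<forall>j \<in> Field r. h j \<in> B \<and> (\<exists>\<alpha> \<in> T. (\<alpha>, h j) \<in> r \<and> h ` underS r j \<subseteq> underS r \<alpha>)"
proof (rule Well_order_dependent_choice)
  show wo: "Well_order r" using r by (rule card_order_on_well_order_on)
  show "(y \<in> B \<and> (\<exists>\<alpha> \<in> T. (\<alpha>, y) \<in> r \<and> f ` underS r j \<subseteq> underS r \<alpha>)) =
      (y \<in> B \<and> (\<exists>\<alpha> \<in> T. (\<alpha>, y) \<in> r \<and> g ` underS r j \<subseteq> underS r \<alpha>))"
    if "\<And>z. z \<in> underS r j \<Longrightarrow> f z = g z" for f g j y
    using image_cong[OF refl that, of "underS r j"] by simp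
  show "\<exists>y. y \<in> B \<and> (\<exists>\<alpha> \<in> T. (\<alpha>, y) \<in> r \<and> f ` underS r j \<subseteq> underS r \<alpha>)"
    if j: "j \<in> Field r"
      and IH: "\<And>i. i \<in> underS r j \<Longrightarrow>
        f i \<in> B \<and> (\<exists>\<alpha> \<in> T. (\<alpha>, f i) \<in> r \<and> f ` underS r i \<subseteq> underS r \<alpha>)" for j f
  proof -
    let ?K = "f ` underS r j"
    have K: "?K \<subseteq> Field r" using IH B by blast
    have "|?K| <o r"
      using card_of_image card_of_underS[OF r j] ordLeq_ordLess_trans by blast
    then have "\<not> |?K| =o r" using not_ordLess_ordIso by blast
    with reg K have "\<not> cofinal ?K r" unfolding regularCard_def by blast
    then obtain a where a: "a \<in> Field r" "\<And>b. b \<in> ?K \<Longrightarrow> a \<notin> underS r b"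
      unfolding cofinal_def underS_def by blast
    obtain \<alpha> where \<alpha>: "\<alpha> \<in> T" "a \<in> underS r \<alpha>"
      using T a unfolding cofinal_def underS_def by blast
    obtain \<beta> where \<beta>: "\<beta> \<in> B" "(\<alpha>, \<beta>) \<in> r"
      using B T \<alpha> unfolding cofinal_def by blast
    have "b \<in> underS r \<alpha>" if b: "b \<in> ?K" for b
    proof (cases "b = a")
      case False
      then have "b \<in> underS r a"
        using Well_order_underS_total[OF wo] a b K by blast
      moreover have "(a, \<alpha>) \<in> r" using \<alpha> underS_E by fastforce
      ultimately show ?thesis using Well_order_underS_mono[OF wo] by blast
    qed (use \<alpha> in simp)
    with \<alpha> \<beta> show ?thesis by blast
  qed
qed

section \<open>Cofinal and stationary sets\<close>

lemma cofinal_if_full_card: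
  assumes r: "Cinfinite r" and B: "B \<subseteq> Field r" "|B| =o r"
  shows "cofinal B r"
  unfolding cofinal_def
proof (rule ballI, rule ccontr)
  fix a assume a: "a \<in> Field r" and neg: "\<not> (\<exists>b \<in> B. a \<noteq> b \<and> (a, b) \<in> r)"
  have wo: "Well_order r" using r card_order_on_well_order_on by blast
  have "b \<in> under r a" if "b \<in> B" for b
    using neg that B a Well_order_not_underS[OF wo, of b a] unfolding under_def underS_def by blast
  then have "B \<subseteq> under r a" by blast
  then have "|B| <o r"
    using card_of_mono1 card_of_under[OF r a] ordLeq_ordLess_trans by blast
  with B show False using not_ordLess_ordIso by blast
qed

lemma cofinal_tail:
  assumes "Well_order r" "cofinal B r" "B \<subseteq> Field r" "x \<in> Field r"
  shows "cofinal {b \<in> B. x \<in> underS r b} r"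
  unfolding cofinal_def
proof
  fix a assume a: "a \<in> Field r"
  obtain b where b: "b \<in> B" "a \<in> underS r b"
    using assms(2) a unfolding cofinal_def underS_def by blast
  obtain d where d: "d \<in> B" "x \<in> underS r d"
    using assms(2,4) unfolding cofinal_def underS_def by blast
  have "\<exists>b \<in> B. x \<in> underS r b \<and> a \<in> underS r b"
  proof (cases "b \<in> underS r d")
    case True
    then show ?thesis using b d Well_order_underS_mono[OF assms(1)] underS_E by fastforce
  next
    case False
    then have "(d, b) \<in> r" using Well_order_not_underS[OF assms(1)] assms(3) b d by blast
    then show ?thesis using b d Well_order_underS_mono[OF assms(1)] by blast
  qed
  then show "\<exists>b \<in> {b \<in> B. x \<in> underS r b}. a \<noteq> b \<and> (a, b) \<in> r"
    unfolding underS_def by blast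
qed

text \<open>Every final segment of \<open>r\<close> is a club, so a stationary set meets it.\<close>

lemma cofinal_if_stationary:
  assumes r: "Cinfinite r" and T: "stationary r T"
  shows "cofinal T r"
  unfolding cofinal_def
proof
  have wo: "Well_order r" using r card_order_on_well_order_on by blast
  fix a assume a: "a \<in> Field r"
  let ?C = "{b \<in> Field r. a \<in> underS r b}"
  have "cofinal (Field r) r"
    using r card_of_Field_ordIso by (blast intro: cofinal_if_full_card)
  then have "cofinal ?C r" using wo a by (intro cofinal_tail) auto
  moreover have "\<alpha> \<in> ?C"
    if \<alpha>: "\<alpha> \<in> limits r" and u: "unbounded_below r \<alpha> (?C \<inter> underS r \<alpha>)" for \<alpha>
  proof -
    obtain \<beta> where "\<beta> \<in> underS r \<alpha>" using \<alpha> unfolding limits_def by blast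
    with u obtain \<gamma> where "a \<in> underS r \<gamma>" "\<gamma> \<in> underS r \<alpha>" unfolding unbounded_below_def by blast
    then have "a \<in> underS r \<alpha>" using Well_order_underS_mono[OF wo] underS_E by fastforce
    with \<alpha> show ?thesis unfolding limits_def by blast
  qed
  ultimately have "club r ?C" unfolding club_def by blast
  with T show "\<exists>b \<in> T. a \<noteq> b \<and> (a, b) \<in> r" unfolding stationary_def underS_def by blast
qed

section \<open>Colourings at a successor cardinal\<close>

lemma cardSuc_pigeonhole:
  assumes k: "Cinfinite k" and c: "\<And>x. x \<in> A \<Longrightarrow> c x \<in> Field k" and A: "|A| =o cardSuc k"
  shows "\<exists>y \<in> Field k. |{x \<in> A. c x = y}| =o cardSuc k"
proof (rule ccontr)
  assume neg: "\<not> ?thesis"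
  have le: "|{x \<in> A. c x = y}| \<le>o k" if y: "y \<in> Field k" for y
  proof -
    have "|{x \<in> A. c x = y}| \<le>o |A|" by (intro card_of_mono1) blast
    then have "|{x \<in> A. c x = y}| \<le>o cardSuc k" using A ordLeq_ordIso_trans by blast
    with neg y have "|{x \<in> A. c x = y}| <o cardSuc k" using ordLeq_iff_ordLess_or_ordIso by blast
    then show ?thesis using k by (simp add: cardSuc_ordLeq_ordLess card_of_Card_order)
  qed
  \<comment> \<open>With all classes of size at most \<open>k\<close>, the set \<open>A\<close> is a
    union of \<open>k\<close> many sets of size at most \<open>k\<close>, hence too small.\<close>
  have "|\<Union>y \<in> Field k. {x \<in> A. c x = y}| \<le>o k"
    using k le card_of_Field_ordIso ordIso_iff_ordLeq
    by (intro card_of_UNION_ordLeq_infinite_Field) (auto simp: cinfinite_def)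
  moreover have "(\<Union>y \<in> Field k. {x \<in> A. c x = y}) = A" using c by blast
  ultimately have "|A| <o cardSuc k"
    using k by (simp add: cardSuc_ordLeq_ordLess card_of_Card_order)
  with A show False using not_ordLess_ordIso by blast
qed

text \<open>This is the thinning argument, freed from the guessing sequence: \<open>B\<close> and
  \<open>T\<close> are arbitrary cofinal sets, so that \<open>B\<close> can later be a tail of a
  guessed set.\<close>

lemma ex_edge_below_guess:
  assumes \<kappa>: "Cinfinite \<kappa>" and r: "r = cardSuc \<kappa>"
    and E: "E \<subseteq> [Field r]\<^bsup>2\<^esup>" "\<not> has_independent_of_size (Field r) E r"
    and B: "B \<subseteq> Field r" "cofinal B r" and T: "T \<subseteq> Field r" "cofinal T r"
  shows "\<exists>\<alpha> \<in> T. \<exists>\<beta> \<in> B. (\<alpha>, \<beta>) \<in> r \<and> \<kappa> \<le>o |{\<gamma> \<in> B \<inter> underS r \<alpha>. {\<gamma>, \<beta>} \<in> E}|"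
proof (rule ccontr)
  assume neg: "\<not> ?thesis"
  have cr: "Card_order r" and reg: "regularCard r"
    using \<kappa> r by (auto simp: cardSuc_Card_order regularCard_cardSuc)
  have wo: "Well_order r" using cr by (rule card_order_on_well_order_on)
  obtain h where h: "\<And>j. j \<in> Field r \<Longrightarrow>
      h j \<in> B \<and> (\<exists>\<alpha> \<in> T. (\<alpha>, h j) \<in> r \<and> h ` underS r j \<subseteq> underS r \<alpha>)"
    using regularCard_interleave[OF cr reg B T] by blast
  \<comment> \<open>The separating \<alpha> makes \<open>h\<close> strictly increasing; only
    injectivity is kept.\<close>
  have hlt: "h i \<noteq> h j" if j: "j \<in> Field r" and i: "i \<in> underS r j" for i j
  proof -
    obtain \<alpha> where "(\<alpha>, h j) \<in> r" "h i \<in> underS r \<alpha>" using h[OF j] i by blast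
    then have "h i \<in> underS r (h j)" using Well_order_underS_mono[OF wo] by blast
    then show ?thesis using underS_E by fastforce
  qed
  note tot = Well_order_underS_total[OF wo]
  have inj: "inj_on h (Field r)"
    by (rule inj_onI) (metis hlt tot)
  have few: "|{i \<in> underS r j. {h i, h j} \<in> E}| <o \<kappa>" if j: "j \<in> Field r" for j
  proof -
    obtain \<alpha> where \<alpha>: "\<alpha> \<in> T" "(\<alpha>, h j) \<in> r" "h ` underS r j \<subseteq> underS r \<alpha>" using h j by blast
    let ?N = "{\<gamma> \<in> B \<inter> underS r \<alpha>. {\<gamma>, h j} \<in> E}"
    have "\<not> \<kappa> \<le>o |?N|" using neg \<alpha> h j by blast
    then have lt: "|?N| <o \<kappa>" 
      using \<kappa> not_ordLeq_iff_ordLess card_of_Well_order card_order_on_well_order_on by blast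
    \<comment> \<open>The greedy colouring acts on indices, so the bound on neighbours of
      \<open>h j\<close> below \<alpha> is pulled back along \<open>h\<close>.\<close>
    have "inj_on h {i \<in> underS r j. {h i, h j} \<in> E}"
      by (rule inj_on_subset[OF inj]) (auto simp: underS_def Field_def)
    moreover have "h ` {i \<in> underS r j. {h i, h j} \<in> E} \<subseteq> ?N"
      using \<alpha> h underS_Field by fastforce
    ultimately have "|{i \<in> underS r j. {h i, h j} \<in> E}| \<le>o |?N|"
      using card_of_ordLeq by blast
    then show ?thesis using lt ordLeq_ordLess_trans by blast
  qed
  obtain c where c: "\<And>j. j \<in> Field r \<Longrightarrow>
      c j \<in> Field \<kappa> \<and> (\<forall>i \<in> underS r j. {h i, h j} \<in> E \<longrightarrow> c i \<noteq> c j)"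
    using greedy_colouring[OF wo, of \<kappa> "\<lambda>i j. {h i, h j} \<in> E"] few \<kappa> by blast
  obtain y where y: "|{j \<in> Field r. c j = y}| =o r"
    using cardSuc_pigeonhole[of \<kappa> "Field r" c] \<kappa> c r cr card_of_Field_ordIso by blast
  \<comment> \<open>Any edge inside this colour class would join two indices that the greedy
    colouring separates.\<close>
  let ?I = "h ` {j \<in> Field r. c j = y}"
  have "bij_betw h {j \<in> Field r. c j = y} ?I"
    using inj by (auto simp: bij_betw_def intro: inj_on_subset)
  then have "|?I| =o r"
    using y card_of_ordIso ordIso_symmetric ordIso_transitive by blast
  moreover have "independent_set (Field r) E ?I"
    unfolding independent_set_def
  proof (intro conjI ballI notI)
    show "?I \<subseteq> Field r" using h B by blast
    fix e assume e: "e \<in> E" "e \<subseteq> ?I"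
    then have "e \<in> [Field r]\<^bsup>2\<^esup>" using E by blast
    then obtain u v where uv: "e = {u, v}" "u \<noteq> v" by (rule nsets2_E)
    have "u \<in> ?I" "v \<in> ?I" using e uv by auto
    then obtain i j where ij: "i \<in> Field r" "j \<in> Field r" "c i = y" "c j = y" "u = h i" "v = h j"
      by (elim imageE CollectE conjE) (rule that)
    then have "i \<noteq> j" using uv by blast
    then consider "i \<in> underS r j" | "j \<in> underS r i" using tot ij by blast
    then show False
    proof cases
      case 1
      then show ?thesis using c[of j] ij uv e by simp
    next
      case 2
      then show ?thesis using c[of i] ij uv e by (simp add: insert_commute)
    qed
  qed
  ultimately show False using E unfolding has_independent_of_size_def by blast
qed

text \<open>An injective selector reserves for each pair \<open>(i, x)\<close> its own point of
  \<open>A i\<close>, which then gets colour \<open>x\<close>. Unreserved points get a default from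
  \<open>Y\<close>, since \<open>X\<close> may be empty.\<close>

lemma ex_rainbow_colouring:
  assumes k: "Cinfinite k" and "|F| \<le>o k" "|X| \<le>o k"
    and A: "\<And>i. i \<in> F \<Longrightarrow> k \<le>o |A i|"
    and X: "X \<subseteq> Y" "Y \<noteq> {}"
  shows "\<exists>f. range f \<subseteq> Y \<and> (\<forall>i \<in> F. X \<subseteq> f ` A i)"
proof -
  have "|F \<times> X| \<le>o k"
    using assms by (intro card_of_Times_ordLeq_infinite_Field) (auto simp: cinfinite_def)
  then have "|F \<times> X| \<le>o |A (fst p)|" if "p \<in> F \<times> X" for p
    using A that ordLeq_transitive by fastforce
  then obtain s where s: "inj_on s (F \<times> X)" "\<forall>p \<in> F \<times> X. s p \<in> A (fst p)"
    using ex_inj_selector[of "F \<times> X" "\<lambda>p. A (fst p)"] by blast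
  obtain y where y: "y \<in> Y" using X by blast
  define f where "f = (\<lambda>a. if a \<in> s ` (F \<times> X) then snd (inv_into (F \<times> X) s a) else y)"
  have "range f \<subseteq> Y"
  proof
    fix z assume "z \<in> range f"
    then obtain a where "z = f a" by blast
    with X y inv_into_into[of a s "F \<times> X"] show "z \<in> Y" by (auto simp: f_def mem_Times_iff)
  qed
  moreover have "x \<in> f ` A i" if "i \<in> F" "x \<in> X" for i x
  proof -
    have p: "(i, x) \<in> F \<times> X" using that by simp
    then have "f (s (i, x)) = x" using s by (simp add: f_def)
    then show ?thesis using s p by (metis fst_conv imageI)
  qed
  ultimately show ?thesis by blast
qed

section \<open>The edge partition obtained from a superclub sequence\<close>

theorem theorem4p3:
  fixes \<kappa> :: "'a rel"
  assumes "Cinfinite \<kappa>" and "regularCard \<kappa>"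
    and "superclub (cardSuc \<kappa>)"
  shows "Q (cardSuc \<kappa>) (cardSuc \<kappa>) (cardSuc \<kappa>)"
proof -
  define r where "r = cardSuc \<kappa>"
  have Cr: "Cinfinite r" using assms(1) Cinfinite_cardSuc r_def by blast
  then have cr: "Card_order r" by blast
  then have wo: "Well_order r" by (rule card_order_on_well_order_on)
  obtain S where S: "superclub_sequence r S"
    using assms(3) unfolding superclub_def r_def by blast
  have "\<exists>P. disjoint_family_on P (Field r) \<and> (\<Union>\<xi> \<in> Field r. P \<xi>) = E \<and>
      (\<forall>\<xi> \<in> Field r. \<not> has_independent_of_size (Field r) (P \<xi>) r)"
    if E: "E \<subseteq> [Field r]\<^bsup>2\<^esup>" "\<not> has_independent_of_size (Field r) E r" for E
  proof -
    \<comment> \<open>\<open>N\<close> collects the neighbours of \<beta> inside a guess, and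
      \<open>F\<close> indexes the guesses where they are numerous. The case \<alpha> = \<beta> is
      allowed, as the separating \<alpha> may equal \<beta>.\<close>
    define N where "N = (\<lambda>\<alpha> \<beta>. {\<gamma> \<in> S \<alpha>. {\<gamma>, \<beta>} \<in> E})"
    define F where "F = (\<lambda>\<beta>. {\<alpha>. (\<alpha>, \<beta>) \<in> r \<and> \<kappa> \<le>o |N \<alpha> \<beta>|})"
    \<comment> \<open>Only the colours below \<beta> are demanded: there are at most \<kappa> of
      them, whereas all of \<open>Field r\<close> would be too many.\<close>
    have "\<exists>f. range f \<subseteq> Field r \<and> (\<forall>\<alpha> \<in> F \<beta>. underS r \<beta> \<subseteq> f ` N \<alpha> \<beta>)"
      if \<beta>: "\<beta> \<in> Field r" for \<beta>
    proof (rule ex_rainbow_colouring[OF assms(1)])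
      have "|underS r \<beta>| <o r" using card_of_underS[OF cr \<beta>] .
      then show "|underS r \<beta>| \<le>o \<kappa>"
        using assms(1) by (simp add: r_def cardSuc_ordLeq_ordLess card_of_Card_order)
      have "|under r \<beta>| <o r" using card_of_under[OF Cr \<beta>] .
      then have "|under r \<beta>| \<le>o \<kappa>"
        using assms(1) by (simp add: r_def cardSuc_ordLeq_ordLess card_of_Card_order)
      moreover have "F \<beta> \<subseteq> under r \<beta>" unfolding F_def under_def by blast
      ultimately show "|F \<beta>| \<le>o \<kappa>" using card_of_mono1 ordLeq_transitive by blast
      show "underS r \<beta> \<subseteq> Field r" "Field r \<noteq> {}" using \<beta> underS_Field by fastforce+
      show "\<kappa> \<le>o |N \<alpha> \<beta>|" if "\<alpha> \<in> F \<beta>" for \<alpha> using that by (simp add: F_def)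
    qed
    then obtain f where f: "\<And>\<beta>. \<beta> \<in> Field r \<Longrightarrow>
        range (f \<beta>) \<subseteq> Field r \<and> (\<forall>\<alpha> \<in> F \<beta>. underS r \<beta> \<subseteq> f \<beta> ` N \<alpha> \<beta>)"
      by metis
    define P where "P = (\<lambda>\<xi>. {e \<in> E. \<exists>\<gamma> \<beta>. e = {\<gamma>, \<beta>} \<and> \<gamma> \<in> underS r \<beta> \<and> f \<beta> \<gamma> = \<xi>})"
    have "disjoint_family_on P (Field r)"
      unfolding disjoint_family_on_def
    proof (intro ballI impI equals0I)
      fix \<xi> \<eta> e assume "\<xi> \<noteq> \<eta>" "e \<in> P \<xi> \<inter> P \<eta>"
      then have "e \<in> P \<xi>" "e \<in> P \<eta>" by simp_all
      then obtain \<gamma> \<beta> \<gamma>' \<beta>' where *: "e = {\<gamma>, \<beta>}" "\<gamma> \<in> underS r \<beta>" "f \<beta> \<gamma> = \<xi>"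
        "e = {\<gamma>', \<beta>'}" "\<gamma>' \<in> underS r \<beta>'" "f \<beta>' \<gamma>' = \<eta>"
        by (simp add: P_def) metis
      \<comment> \<open>Equal ordered pairs would have equal colours, so the endpoints must be
        swapped, against asymmetry.\<close>
      with \<open>\<xi> \<noteq> \<eta>\<close> have "\<gamma> = \<beta>'" "\<beta> = \<gamma>'" by (auto simp: doubleton_eq_iff)
      with * Well_order_underS_asym[OF wo] show False by blast
    qed
    moreover have "(\<Union>\<xi> \<in> Field r. P \<xi>) = E"
    proof
      show "(\<Union>\<xi> \<in> Field r. P \<xi>) \<subseteq> E" unfolding P_def by blast
      show "E \<subseteq> (\<Union>\<xi> \<in> Field r. P \<xi>)"
      proof
        fix e assume e: "e \<in> E"
        then have "e \<in> [Field r]\<^bsup>2\<^esup>" using E by blast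
        then obtain x y where xy: "e = {x, y}" "x \<in> Field r" "y \<in> Field r" "x \<noteq> y"
          by (rule nsets2_E)
        then have "x \<in> underS r y \<or> y \<in> underS r x"
          using Well_order_underS_total[OF wo] by blast
        then obtain \<gamma> \<beta> where "e = {\<gamma>, \<beta>}" "\<gamma> \<in> underS r \<beta>" "\<beta> \<in> Field r"
          using xy by (metis insert_commute)
        then show "e \<in> (\<Union>\<xi> \<in> Field r. P \<xi>)" using e f unfolding P_def by blast
      qed
    qed
    moreover have "\<not> has_independent_of_size (Field r) (P \<xi>) r" if \<xi>: "\<xi> \<in> Field r" for \<xi>
    proof
      assume "has_independent_of_size (Field r) (P \<xi>) r"
      then obtain I where I: "I \<subseteq> Field r" "|I| =o r" and ind: "\<And>e. e \<in> P \<xi> \<Longrightarrow> \<not> e \<subseteq> I"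
        unfolding has_independent_of_size_def independent_set_def by blast
      then obtain B where B: "B \<subseteq> I" "|B| =o r"
        and T: "stationary r {\<alpha> \<in> limits r. B \<inter> underS r \<alpha> = S \<alpha>}" (is "stationary r ?T")
        using S unfolding superclub_sequence_def by blast
      \<comment> \<open>Above \<xi>, the colour \<xi> is among those that every large
        \<open>N \<alpha> \<beta>\<close> must receive.\<close>
      let ?B = "{\<beta> \<in> B. \<xi> \<in> underS r \<beta>}"
      have Bsub: "B \<subseteq> Field r" using B I by blast
      have "cofinal ?B r"
        using cofinal_tail[OF wo cofinal_if_full_card[OF Cr Bsub B(2)] Bsub \<xi>] .
      moreover have "cofinal ?T r" using cofinal_if_stationary[OF Cr T] .
      moreover have "?T \<subseteq> Field r" unfolding limits_def by blast
      ultimately obtain \<alpha> \<beta> where \<alpha>: "\<alpha> \<in> ?T" and \<beta>: "\<beta> \<in> ?B" and \<alpha>\<beta>: "(\<alpha>, \<beta>) \<in> r"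
        and large: "\<kappa> \<le>o |{\<gamma> \<in> ?B \<inter> underS r \<alpha>. {\<gamma>, \<beta>} \<in> E}|"
        using ex_edge_below_guess[OF assms(1) r_def E, of ?B ?T] Bsub by blast
      \<comment> \<open>The guess \<open>S \<alpha>\<close> equals
        \<open>B \<inter> underS r \<alpha>\<close>, which contains the corresponding part of the
        tail \<open>?B\<close>.\<close>
      have "{\<gamma> \<in> ?B \<inter> underS r \<alpha>. {\<gamma>, \<beta>} \<in> E} \<subseteq> N \<alpha> \<beta>"
        using \<alpha> unfolding N_def by blast
      with large have "\<alpha> \<in> F \<beta>"
        using \<alpha>\<beta> card_of_mono1 ordLeq_transitive unfolding F_def by blast
      then have "\<xi> \<in> f \<beta> ` N \<alpha> \<beta>" using f[of \<beta>] \<beta> Bsub by blast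
      then obtain \<gamma> where \<gamma>: "\<gamma> \<in> S \<alpha>" "{\<gamma>, \<beta>} \<in> E" "f \<beta> \<gamma> = \<xi>" unfolding N_def by blast
      \<comment> \<open>A correct guess puts \<gamma> back into \<open>B\<close>, so the edge of
        colour \<xi> lies inside \<open>I\<close>.\<close>
      then have "\<gamma> \<in> B" "\<gamma> \<in> underS r \<beta>"
        using \<alpha> Well_order_underS_mono[OF wo \<alpha>\<beta>] by blast+
      with \<gamma> have "{\<gamma>, \<beta>} \<in> P \<xi>" unfolding P_def by blast
      with ind \<open>\<gamma> \<in> B\<close> \<beta> B show False by blast
    qed
    ultimately show ?thesis by blast
  qed
  then show ?thesis unfolding Q_def r_def[symmetric] by blast
qed

end
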